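(* Let $n\geqslant3$ and $\alpha\in(0,2]$. If a closed set $F\subset\mathbb R^n$ with $F\neq\mathbb R^n$ is not $\alpha$-thin at infinity, then $c_{\kappa_\alpha}(F)=\infty$. This cannot be reversed, i.e. there is a closed set $F\subset\mathbb R^n$, $F\ne\mathbb R^n$, with $c_{\kappa_\alpha}(F)=\infty$ that is $\alpha$-thin at infinity.
   Context: $\kappa_\alpha(x,y):=|x-y|^{\alpha-n}$ is the $\alpha$-Riesz kernel on $\mathbb R^n$, $|x-y|$ being the Euclidean distance. For $Q\subset\mathbb R^n$, the (inner) capacity is $c_{\kappa_\alpha}(Q):=\bigl[\inf\iint\kappa_\alpha(x,y)\,d\nu(x)\,d\nu(y)\bigr]^{-1}$, where $\nu$ ranges over positive Radon measures of finite energy carried by $Q$ with $\nu(Q)=1$ ($\inf\varnothing=+\infty$, $1/(+\infty)=0$, $1/0=+\infty$). Let $F\subset\mathbb R^n$ be closed with $F^c:=\mathbb R^n\setminus F\ne\varnothing$, and fix $x_0\in F^c$. $F$ is called $\alpha$-thin at infinity if $$\sum_{k\in\mathbb N}\frac{c_{\kappa_\alpha}(F_k)}{q^{k(n-\alpha)}}<\infty,\qquad F_k:=F\cap\{x\in\mathbb R^n:\ q^k\leqslant|x-x_0|<q^{k+1}\},$$ where $q\in(1,\infty)$. (This is known to be equivalent to: the inverse $F^*$ of $F$ relative to the sphere $\{|x-x_0|=1\}$ is $\alpha$-thin at $x_0$; equivalently, either $F$ is compact or $x_0$ is an $\alpha$-irregular boundary point of $F^*$.) *)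

theory Defs
  imports "HOL-Analysis.Analysis"
begin

text \<open>The kernel takes the value \<open>\<infinity>\<close> on the diagonal, which is the continuous extension for
  \<open>\<alpha> < n\<close>; it is set explicitly because \<open>0 powr a = 0\<close>.\<close>

definition riesz_kernel :: "real \<Rightarrow> real ^ 'n \<Rightarrow> real ^ 'n \<Rightarrow> ennreal" where
  "riesz_kernel \<alpha> x y =
     (if x = y then \<infinity> else ennreal (dist x y powr (\<alpha> - real CARD('n))))"

definition radon_measure :: "'a::topological_space measure \<Rightarrow> bool" where
  "radon_measure \<nu> \<longleftrightarrow>
     sets \<nu> = sets borel \<and>
     (\<forall>K. compact K \<longrightarrow> emeasure \<nu> K < \<infinity>) \<and>
     (\<forall>B\<in>sets borel. emeasure \<nu> B = (SUP K\<in>{K. K \<subseteq> B \<and> compact K}. emeasure \<nu> K))"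

definition riesz_energy :: "real \<Rightarrow> (real ^ 'n) measure \<Rightarrow> ennreal" where
  "riesz_energy \<alpha> \<nu> = (\<integral>\<^sup>+ x. \<integral>\<^sup>+ y. riesz_kernel \<alpha> x y \<partial>\<nu> \<partial>\<nu>)"

text \<open>Being carried by \<open>Q\<close> means that the complement of \<open>Q\<close> is \<open>\<nu>\<close>-negligible. The completion
  gives \<open>\<nu>(Q)\<close> its meaning also for those carriers \<open>Q\<close> that are not Borel.\<close>

definition unit_measures_on :: "real \<Rightarrow> (real ^ 'n) set \<Rightarrow> (real ^ 'n) measure set" where
  "unit_measures_on \<alpha> Q =
     {\<nu>. radon_measure \<nu> \<and> riesz_energy \<alpha> \<nu> < \<infinity> \<and>
         (AE x in \<nu>. x \<in> Q) \<and> emeasure (completion \<nu>) Q = 1}"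

text \<open>In \<^typ>\<open>ennreal\<close>, the infimum of the empty set is \<open>\<infinity>\<close>, \<open>inverse \<infinity> = 0\<close> and
  \<open>inverse 0 = \<infinity>\<close>.\<close>

definition riesz_capacity :: "real \<Rightarrow> (real ^ 'n) set \<Rightarrow> ennreal" where
  "riesz_capacity \<alpha> Q = inverse (INF \<nu>\<in>unit_measures_on \<alpha> Q. riesz_energy \<alpha> \<nu>)"

text \<open>The notion is meant for \<open>q > 1\<close> and \<open>x\<^sub>0 \<notin> F\<close>, and then does not depend on \<open>q\<close> and \<open>x\<^sub>0\<close>.\<close>

definition thin_at_infinity :: "real \<Rightarrow> real \<Rightarrow> real ^ 'n \<Rightarrow> (real ^ 'n) set \<Rightarrow> bool" where
  "thin_at_infinity \<alpha> q x0 F \<longleftrightarrow>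
     (\<Sum>k. riesz_capacity \<alpha> (F \<inter> {x. q ^ k \<le> dist x x0 \<and> dist x x0 < q ^ Suc k})
           / ennreal (q powr (real k * (real CARD('n) - \<alpha>)))) < \<infinity>"

end

(* A piece of F has at most the capacity of F, so if the capacity of F is finite, the series defining
   thinness is dominated by a geometric one.  For the counterexample, take balls of radius j + 1 at
   distance 4^j from the origin: arbitrarily large balls force infinite capacity, whereas the capacity
   of the part in the k-th annulus grows only polynomially in k. *)

theory Submission
  imports Defs "HOL-Probability.Probability_Measure" "HOL-Real_Asymp.Real_Asymp"
begin

section \<open>Monotonicity of the capacity\<close>

lemma inverse_ennreal_antimono:
  fixes a b :: ennreal
  assumes "a \<le> b"
  shows "inverse b \<le> inverse a"
  using assms
  by (cases a rule: ennreal_cases; cases b rule: ennreal_cases; cases "a = 0"; cases "b = 0")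
     (auto simp: inverse_ennreal top_unique ennreal_zero_less_divide le_imp_inverse_le)

lemma ennreal_le_suminf:
  fixes f :: "nat \<Rightarrow> ennreal"
  shows "f k \<le> suminf f"
  using sum_le_suminf[of f "{k}"] by simp

text \<open>The complement of \<open>Q\<close> lies in a null set, so \<open>Q\<close> becomes
  measurable in the completion even when it is not Borel. The condition on the mass of the carrier
  thus reduces to one on the total mass, which does not mention \<open>Q\<close>.\<close>

lemma AE_emeasure_completion:
  fixes \<nu> :: "'a::topological_space measure"
  assumes "sets \<nu> = sets borel" "AE x in \<nu>. x \<in> Q"
  shows "emeasure (completion \<nu>) Q = emeasure \<nu> UNIV"
proof -
  have space: "space \<nu> = UNIV"
    using assms(1) sets_eq_imp_space_eq by fastforce
  have "Measurable.pred (completion \<nu>) (\<lambda>x. \<not> x \<in> Q)"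
    by (rule sets_completion_AE) (use assms in simp)
  then have "- Q \<in> sets (completion \<nu>)"
    by (simp add: pred_def space Compl_eq)
  from sets.compl_sets[OF this] have "Q \<in> sets (completion \<nu>)"
    by (simp add: space flip: Compl_eq_Diff_UNIV)
  then have "emeasure (completion \<nu>) Q = emeasure (completion \<nu>) UNIV"
    by (intro emeasure_eq_AE) (use assms in \<open>auto simp: AE_completion_iff space[symmetric]\<close>)
  then show ?thesis
    using assms(1) by simp
qed

lemma unit_measures_on_mono:
  assumes "Q \<subseteq> Q'"
  shows "unit_measures_on \<alpha> Q \<subseteq> unit_measures_on \<alpha> Q'"
proof
  fix \<nu> assume \<nu>: "\<nu> \<in> unit_measures_on \<alpha> Q"
  then have AE: "AE x in \<nu>. x \<in> Q" and sets: "sets \<nu> = sets borel"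
    by (auto simp: unit_measures_on_def radon_measure_def)
  have AE': "AE x in \<nu>. x \<in> Q'"
    using AE by (rule eventually_mono) (use assms in auto)
  show "\<nu> \<in> unit_measures_on \<alpha> Q'"
    using \<nu> AE' AE_emeasure_completion[OF sets AE] AE_emeasure_completion[OF sets AE']
    by (simp add: unit_measures_on_def)
qed

lemma riesz_capacity_mono:
  "Q \<subseteq> Q' \<Longrightarrow> riesz_capacity \<alpha> Q \<le> riesz_capacity \<alpha> Q'"
  unfolding riesz_capacity_def
  by (intro inverse_ennreal_antimono INF_superset_mono unit_measures_on_mono) auto

section \<open>Upper bounds for the capacity from finite covers\<close>

text \<open>Since \<alpha> < n, the kernel decreases with distance, so on \<open>A\<close> times
  \<open>A\<close> it is at least its value at distance \<open>d\<close>; on the diagonal it is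
  infinite. Only this part of the double integral is kept.\<close>

lemma riesz_energy_ge:
  fixes A :: "(real ^ 'n) set"
  assumes \<alpha>: "\<alpha> < real CARD('n)" and sets: "sets \<nu> = sets borel" and A: "A \<in> sets borel"
    and d: "0 < d" "\<And>x y. x \<in> A \<Longrightarrow> y \<in> A \<Longrightarrow> dist x y \<le> d"
  shows "ennreal (d powr (\<alpha> - real CARD('n))) * (emeasure \<nu> A)\<^sup>2 \<le> riesz_energy \<alpha> \<nu>"
proof -
  let ?c = "ennreal (d powr (\<alpha> - real CARD('n)))"
  have [measurable]: "A \<in> sets \<nu>"
    using A sets by simp
  have le: "?c \<le> riesz_kernel \<alpha> x y" if "x \<in> A" "y \<in> A" for x y
    using d(2)[OF that] d(1) \<alpha> by (auto simp: riesz_kernel_def intro!: ennreal_leI powr_mono2')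
  have "?c * (emeasure \<nu> A)\<^sup>2 = (\<integral>\<^sup>+ x. (?c * emeasure \<nu> A) * indicator A x \<partial>\<nu>)"
    by (subst nn_integral_cmult_indicator) (simp_all add: power2_eq_square mult_ac)
  also have "\<dots> \<le> riesz_energy \<alpha> \<nu>"
    unfolding riesz_energy_def
  proof (rule nn_integral_mono)
    fix x
    have "?c * emeasure \<nu> A * indicator A x = (\<integral>\<^sup>+ y. ?c * indicator A y \<partial>\<nu>) * indicator A x"
      by (simp add: nn_integral_cmult_indicator)
    also have "\<dots> \<le> (\<integral>\<^sup>+ y. riesz_kernel \<alpha> x y \<partial>\<nu>)"
      using le by (auto simp: indicator_def intro!: nn_integral_mono)
    finally show "?c * emeasure \<nu> A * indicator A x \<le> (\<integral>\<^sup>+ y. riesz_kernel \<alpha> x y \<partial>\<nu>)" .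
  qed
  finally show ?thesis .
qed

text \<open>By pigeonhole, one of the \<open>N\<close> sets carries mass at least \<open>1 / N\<close>.\<close>

lemma riesz_capacity_le_cover:
  fixes A :: "'i \<Rightarrow> (real ^ 'n) set"
  assumes \<alpha>: "\<alpha> < real CARD('n)" and I: "finite I" "card I \<le> N" and N: "0 < N"
    and A: "\<And>i. i \<in> I \<Longrightarrow> A i \<in> sets borel" and Q: "Q \<subseteq> (\<Union>i\<in>I. A i)"
    and d: "0 < d" "\<And>i x y. i \<in> I \<Longrightarrow> x \<in> A i \<Longrightarrow> y \<in> A i \<Longrightarrow> dist x y \<le> d"
  shows "riesz_capacity \<alpha> Q \<le> ennreal (real N ^ 2 * d powr (real CARD('n) - \<alpha>))"
proof -
  let ?b = "real N ^ 2 * d powr (real CARD('n) - \<alpha>)"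
  have b: "0 < ?b"
    using N d by simp
  have "inverse (ennreal ?b) \<le> riesz_energy \<alpha> \<nu>" if "\<nu> \<in> unit_measures_on \<alpha> Q" for \<nu>
  proof -
    from that have sets: "sets \<nu> = sets borel" and AE: "AE x in \<nu>. x \<in> Q"
      and one: "emeasure (completion \<nu>) Q = 1"
      by (auto simp: unit_measures_on_def radon_measure_def)
    have A': "A i \<in> sets \<nu>" if "i \<in> I" for i
      using A[OF that] sets by simp
    have "1 = emeasure \<nu> UNIV"
      using AE_emeasure_completion[OF sets AE] one by simp
    also have "\<dots> \<le> emeasure \<nu> (\<Union>i\<in>I. A i)"
      by (rule emeasure_mono_AE) (use AE Q A' I in \<open>auto elim!: eventually_mono\<close>)
    also have "\<dots> \<le> (\<Sum>i\<in>I. emeasure \<nu> (A i))"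
      by (rule emeasure_subadditive_finite) (use A' I in auto)
    finally have ge: "1 \<le> (\<Sum>i\<in>I. emeasure \<nu> (A i))" .
    then have "I \<noteq> {}"
      by auto
    then obtain i where i: "i \<in> I" and max: "\<And>j. j \<in> I \<Longrightarrow> emeasure \<nu> (A j) \<le> emeasure \<nu> (A i)"
      using obtains_MAX[OF I(1), of "\<lambda>i. emeasure \<nu> (A i)"] I(1)
      by (metis Max_ge finite_imageI image_eqI)
    have inv_N: "inverse (of_nat N) * of_nat N = (1 :: ennreal)"
      using N by (simp add: ennreal_of_nat_eq_real_of_nat inverse_ennreal flip: ennreal_mult)
    have "1 \<le> of_nat (card I) * emeasure \<nu> (A i)"
      using order.trans[OF ge sum_bounded_above[OF max]] by simp
    also have "\<dots> \<le> of_nat N * emeasure \<nu> (A i)"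
      using I by (intro mult_right_mono) auto
    finally have "inverse (of_nat N) * 1 \<le> inverse (of_nat N) * (of_nat N * emeasure \<nu> (A i))"
      by (rule mult_left_mono) simp
    then have mass: "inverse (of_nat N) \<le> emeasure \<nu> (A i)"
      by (simp add: inv_N flip: mult.assoc)
    \<comment> \<open>The mass \<open>1 / N\<close> enters the energy squared, which produces the
      factor \<open>N ^ 2\<close> in the capacity bound.\<close>
    have "inverse (ennreal ?b)
        = ennreal (d powr (\<alpha> - real CARD('n))) * (inverse (of_nat N))\<^sup>2"
    proof -
      have "inverse ?b = d powr (\<alpha> - real CARD('n)) * (inverse (real N))\<^sup>2"
        by (simp add: power_inverse mult.commute flip: powr_minus)
      moreover have "inverse (of_nat N) = ennreal (inverse (real N))"
        using N by (simp add: ennreal_of_nat_eq_real_of_nat inverse_ennreal)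
      ultimately show ?thesis
        by (simp only: inverse_ennreal[OF b]) (simp add: ennreal_mult ennreal_power)
    qed
    also have "\<dots> \<le> ennreal (d powr (\<alpha> - real CARD('n))) * (emeasure \<nu> (A i))\<^sup>2"
      by (intro mult_left_mono power_mono mass) auto
    also have "\<dots> \<le> riesz_energy \<alpha> \<nu>"
      using A i d by (intro riesz_energy_ge \<alpha> sets) auto
    finally show ?thesis .
  qed
  then have "inverse (ennreal ?b) \<le> (INF \<nu>\<in>unit_measures_on \<alpha> Q. riesz_energy \<alpha> \<nu>)"
    by (rule INF_greatest)
  from inverse_ennreal_antimono[OF this] show ?thesis
    using b by (simp only: riesz_capacity_def inverse_ennreal inverse_inverse_eq inverse_positive_iff_positive)
qed

section \<open>Thinness by comparison with a convergent series\<close>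

text \<open>Termwise comparison moves the question from a series in \<open>ennreal\<close> to
  summability of a real series.\<close>

lemma thin_at_infinityI:
  fixes F :: "(real ^ 'n) set"
  assumes "0 < q" and b: "\<And>k. 0 \<le> b k"
    and le: "\<And>k. riesz_capacity \<alpha> (F \<inter> {x. q ^ k \<le> dist x x0 \<and> dist x x0 < q ^ Suc k})
                  \<le> ennreal (b k)"
    and sum: "summable (\<lambda>k. b k / q powr (real k * (real CARD('n) - \<alpha>)))"
  shows "thin_at_infinity \<alpha> q x0 F"
proof -
  have nonneg: "0 \<le> b k / q powr (real k * (real CARD('n) - \<alpha>))" for k
    using b by simp
  have "(\<Sum>k. riesz_capacity \<alpha> (F \<inter> {x. q ^ k \<le> dist x x0 \<and> dist x x0 < q ^ Suc k})
           / ennreal (q powr (real k * (real CARD('n) - \<alpha>))))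
      \<le> (\<Sum>k. ennreal (b k / q powr (real k * (real CARD('n) - \<alpha>))))"
  proof (intro suminf_le summableI)
    fix k
    have "ennreal (b k / q powr (real k * (real CARD('n) - \<alpha>)))
        = ennreal (b k) / ennreal (q powr (real k * (real CARD('n) - \<alpha>)))"
      by (rule divide_ennreal[symmetric]) (use b \<open>0 < q\<close> in simp_all)
    then show "riesz_capacity \<alpha> (F \<inter> {x. q ^ k \<le> dist x x0 \<and> dist x x0 < q ^ Suc k})
           / ennreal (q powr (real k * (real CARD('n) - \<alpha>)))
        \<le> ennreal (b k / q powr (real k * (real CARD('n) - \<alpha>)))"
      using divide_right_mono_ennreal[OF le[of k]] by metis
  qed
  also have "\<dots> < \<infinity>"
    using ennreal_suminf_neq_top[OF sum nonneg] by (simp only: infinity_ennreal_def top.not_eq_extremum)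
  finally show ?thesis
    by (simp add: thin_at_infinity_def)
qed

lemma thin_at_infinity_if_finite_capacity:
  fixes F :: "(real ^ 'n) set"
  assumes "\<alpha> < real CARD('n)" "1 < q" "riesz_capacity \<alpha> F \<noteq> \<infinity>"
  shows "thin_at_infinity \<alpha> q x0 F"
proof -
  obtain c where c: "0 \<le> c" "riesz_capacity \<alpha> F = ennreal c"
    using assms(3) by (cases "riesz_capacity \<alpha> F" rule: ennreal_cases) auto
  show ?thesis
  proof (rule thin_at_infinityI)
    show "0 < q"
      using assms by simp
    show "riesz_capacity \<alpha> (F \<inter> {x. q ^ k \<le> dist x x0 \<and> dist x x0 < q ^ Suc k}) \<le> ennreal c" for k
      unfolding c(2)[symmetric] by (rule riesz_capacity_mono) auto
    \<comment> \<open>A constant bound on the capacities leaves a geometric series, with ratio less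
      than 1 because q > 1 and \<alpha> < n.\<close>
    have eq: "c / q powr (real k * (real CARD('n) - \<alpha>)) = c * (q powr (\<alpha> - real CARD('n))) ^ k" for k
      using \<open>0 < q\<close>
      by (simp add: powr_power divide_inverse algebra_simps flip: powr_minus)
    show "summable (\<lambda>k. c / q powr (real k * (real CARD('n) - \<alpha>)))"
      unfolding eq using assms
      by (intro summable_mult summable_geometric) (simp add: powr_less_one)
  qed (rule c(1))
qed

section \<open>Infinite capacity of sets containing arbitrarily large balls\<close>

lemma borel_measurable_riesz_kernel [measurable]: "riesz_kernel \<alpha> x \<in> borel_measurable borel"
  unfolding riesz_kernel_def by measurable

text \<open>Dyadic decomposition around \<open>x\<close>: at distances between
  \<open>r k / 2\<close> and \<open>r k\<close> the kernel is at most
  \<open>(r k / 2) powr (\<alpha> - n)\<close>, and the enclosing ball has volume of order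
  \<open>r k ^ n\<close>. The products form a geometric series, and none of them depends on
  \<open>x\<close>.\<close>

lemma riesz_kernel_locally_integrable:
  assumes \<alpha>: "0 < \<alpha>" "\<alpha> < real CARD('n)" and s: "0 < s"
  obtains C where "0 \<le> C"
    "\<And>x :: real ^ 'n. (\<integral>\<^sup>+ y. riesz_kernel \<alpha> x y * indicator (ball x s) y \<partial>lborel) \<le> ennreal C"
proof -
  let ?n = "real CARD('n)"
  define r where "r k = s / 2 ^ k" for k :: nat
  define \<omega> where "\<omega> = unit_ball_vol ?n"
  define a where "a k = (r k / 2) powr (\<alpha> - ?n) * (\<omega> * r k ^ CARD('n))" for k
  have r: "0 < r k" for k
    using s by (simp add: r_def)
  have a_nonneg: "0 \<le> a k" for k
    using r[of k] by (simp add: a_def \<omega>_def)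
  \<comment> \<open>The exponents \<alpha> - n and n add up to \<alpha>, so halving the radius
    multiplies the term by \<open>2 powr - \<alpha>\<close>, which is less than 1 because \<alpha> >
    0.\<close>
  have a_eq: "a k = (\<omega> * 2 powr (?n - \<alpha>) * s powr \<alpha>) * (2 powr - \<alpha>) ^ k" for k
  proof -
    have "r k ^ CARD('n) = r k powr ?n"
      using r[of k] by (simp add: powr_realpow)
    moreover have "(r k / 2) powr (\<alpha> - ?n) = r k powr (\<alpha> - ?n) * 2 powr (?n - \<alpha>)"
      using r[of k] powr_minus_divide[of 2 "\<alpha> - ?n"] by (simp add: powr_divide)
    moreover have "r k powr \<alpha> = s powr \<alpha> * (2 powr - \<alpha>) ^ k"
    proof -
      have "r k = s * 2 powr - real k"
        by (simp add: r_def powr_minus powr_realpow divide_inverse)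
      then show ?thesis
        using s by (simp add: powr_mult powr_powr powr_power mult.commute)
    qed
    ultimately show ?thesis
      by (simp add: a_def flip: powr_add)
  qed
  have "summable a"
    unfolding a_eq[abs_def] using \<alpha>
    by (intro summable_mult summable_geometric) (simp add: powr_less_one)
  have "(\<integral>\<^sup>+ y. riesz_kernel \<alpha> x y * indicator (ball x s) y \<partial>lborel) \<le> ennreal (suminf a)"
    for x :: "real ^ 'n"
  proof -
    \<comment> \<open>Full balls replace the dyadic shells; this only enlarges the majorant and
      makes each integral a ball volume.\<close>
    let ?t = "\<lambda>k y. ennreal ((r k / 2) powr (\<alpha> - ?n)) * indicator (cball x (r k)) y :: ennreal"
    have le: "riesz_kernel \<alpha> x y * indicator (ball x s) y \<le> (\<Sum>k. ?t k y)" if "y \<noteq> x" for y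
    proof (cases "y \<in> ball x s")
      case True
      let ?\<rho> = "dist x y"
      have \<rho>: "0 < ?\<rho>" "?\<rho> < s"
        using True that by auto
      \<comment> \<open>The first radius below the distance has a predecessor, since
        \<open>r 0 = s\<close> exceeds the distance. That predecessor \<open>r k\<close> is the
        radius of the shell containing \<open>y\<close>.\<close>
      define m where "m = (LEAST m. r m < ?\<rho>)"
      obtain m' where "(1 / 2) ^ m' < ?\<rho> / s"
        using real_arch_pow_inv[of "?\<rho> / s" "1 / 2"] \<rho> s by auto
      then have "r m' < ?\<rho>"
        using s by (simp add: r_def field_simps power_divide)
      then have m: "r m < ?\<rho>"
        unfolding m_def by (rule LeastI)
      have "m \<noteq> 0"
        using m \<rho> by (cases "m = 0") (simp_all add: r_def)
      then obtain k where k: "m = Suc k"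
        using not0_implies_Suc by blast
      have "\<not> r k < ?\<rho>"
        using not_less_Least[of k "\<lambda>m. r m < ?\<rho>"] k by (simp add: m_def)
      moreover have "r k / 2 < ?\<rho>"
        using m k by (simp add: r_def field_simps)
      ultimately have "riesz_kernel \<alpha> x y * indicator (ball x s) y \<le> ?t k y"
        using True that \<alpha> r[of k]
        by (auto simp: riesz_kernel_def intro!: ennreal_leI powr_mono2')
      also have "\<dots> \<le> (\<Sum>k. ?t k y)"
        by (rule ennreal_le_suminf)
      finally show ?thesis .
    qed simp
    have "(\<integral>\<^sup>+ y. riesz_kernel \<alpha> x y * indicator (ball x s) y \<partial>lborel) \<le> (\<integral>\<^sup>+ y. (\<Sum>k. ?t k y) \<partial>lborel)"
      \<comment> \<open>The pointwise bound leaves out the single point \<open>y = x\<close>, which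
        is Lebesgue-null.\<close>
      by (rule nn_integral_mono_AE) (use AE_lborel_singleton[of x] le in \<open>auto elim!: eventually_mono\<close>)
    also have "\<dots> = (\<Sum>k. \<integral>\<^sup>+ y. ?t k y \<partial>lborel)"
      by (intro nn_integral_suminf borel_measurable_times_ennreal borel_measurable_const
            borel_measurable_indicator) simp
    also have "\<dots> = (\<Sum>k. ennreal (a k))"
    proof (rule suminf_cong)
      fix k
      have "(\<integral>\<^sup>+ y. ?t k y \<partial>lborel) = ennreal ((r k / 2) powr (\<alpha> - ?n)) * emeasure lborel (cball x (r k))"
        by (rule nn_integral_cmult_indicator) simp
      also have "\<dots> = ennreal (a k)"
        using r[of k] by (subst emeasure_cball) (simp_all add: a_def \<omega>_def ennreal_mult less_imp_le)
      finally show "(\<integral>\<^sup>+ y. ?t k y \<partial>lborel) = ennreal (a k)" .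
    qed
    also have "\<dots> = ennreal (suminf a)"
      by (rule suminf_ennreal2[OF a_nonneg \<open>summable a\<close>])
    finally show ?thesis .
  qed
  then show thesis
    using suminf_nonneg[OF \<open>summable a\<close> a_nonneg] that by blast
qed

text \<open>Finite Borel measures on a Euclidean space are automatically inner regular by compact
  sets.\<close>

lemma radon_measure_uniform_measure_lborel:
  fixes A :: "'a::euclidean_space set"
  assumes "emeasure lborel A \<noteq> 0" "emeasure lborel A \<noteq> \<infinity>"
  shows "radon_measure (uniform_measure lborel A)"
proof -
  interpret prob_space "uniform_measure lborel A"
    by (rule prob_space_uniform_measure[OF assms])
  show ?thesis
    unfolding radon_measure_def
    by (auto simp: less_top[symmetric] intro!: inner_regular)
qed

text \<open>The witnesses are normalised Lebesgue measures on balls: inside distance \<open>s\<close> the potential is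
  \<open>O(1 / R ^ n)\<close> by local integrability of the kernel, and outside it is at most \<open>s\<close> to the power
  \<open>\<alpha> - n\<close>.\<close>

lemma riesz_capacity_eq_infinity:
  fixes F :: "(real ^ 'n) set"
  assumes \<alpha>: "0 < \<alpha>" "\<alpha> < real CARD('n)" and F: "\<And>R. \<exists>p. cball p R \<subseteq> F"
  shows "riesz_capacity \<alpha> F = \<infinity>"
proof -
  let ?n = "real CARD('n)"
  \<comment> \<open>An infimum of zero is enough, as \<open>inverse 0\<close> is infinite in
    \<open>ennreal\<close>.\<close>
  have "(INF \<nu>\<in>unit_measures_on \<alpha> F. riesz_energy \<alpha> \<nu>) \<le> 0"
  proof (rule ennreal_le_epsilon)
    fix e :: real assume e: "0 < e"
    \<comment> \<open>Chosen so that the kernel equals \<open>e / 2\<close> at distance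
      \<open>s\<close>, and is no larger beyond it.\<close>
    define s where "s = (e / 2) powr (1 / (\<alpha> - ?n))"
    have s: "0 < s" and s_powr: "s powr (\<alpha> - ?n) = e / 2"
      using e \<alpha> by (auto simp: s_def powr_powr)
    obtain C where C: "0 \<le> C"
      "\<And>x :: real ^ 'n. (\<integral>\<^sup>+ y. riesz_kernel \<alpha> x y * indicator (ball x s) y \<partial>lborel) \<le> ennreal C"
      using riesz_kernel_locally_integrable[OF \<alpha> s] by blast
    define \<omega> where "\<omega> = unit_ball_vol ?n"
    have \<omega>: "0 < \<omega>"
      by (simp add: \<omega>_def)
    \<comment> \<open>Large enough that the near part \<open>C / V\<close> is at most
      \<open>e / 2\<close>. The maximum with 1 ensures \<open>R \<le> R ^ n\<close>, hence that the
      volume \<open>V\<close> is at least \<open>\<omega> * R\<close>.\<close>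
    define R where "R = max 1 (2 * C / (e * \<omega>))"
    have R: "1 \<le> R" "2 * C / (e * \<omega>) \<le> R"
      by (auto simp: R_def)
    define V where "V = \<omega> * R ^ CARD('n)"
    have V: "0 < V"
      using \<omega> R by (simp add: V_def)
    have "2 * C \<le> e * (\<omega> * R)"
      using R(2) e \<omega> by (simp add: field_simps)
    also have "\<omega> * R \<le> V"
      using \<omega> R(1) self_le_power[of R "CARD('n)"] by (simp add: V_def)
    finally have CV: "C / V \<le> e / 2"
      using e V by (simp add: field_simps)
    obtain p where p: "cball p R \<subseteq> F"
      using F by blast
    define A where "A = cball p R"
    have [measurable]: "A \<in> sets borel"
      by (simp add: A_def)
    have emeasure_A: "emeasure lborel A = ennreal V"
      using R by (simp add: A_def emeasure_cball V_def \<omega>_def)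
    define \<nu> where "\<nu> = uniform_measure lborel A"
    have A_fin: "emeasure lborel A \<noteq> 0" "emeasure lborel A \<noteq> \<infinity>"
      using V by (auto simp: emeasure_A)
    interpret prob_space \<nu>
      unfolding \<nu>_def by (rule prob_space_uniform_measure[OF A_fin])
    have sets: "sets \<nu> = sets borel"
      by (simp add: \<nu>_def)
    \<comment> \<open>Split at distance \<open>s\<close>: before normalisation the near part is at
      most \<open>C\<close> and the far part at most \<open>e / 2 * V\<close>. Division by
      \<open>V\<close> turns the sum into \<open>C / V + e / 2\<close>.\<close>
    have potential: "(\<integral>\<^sup>+ y. riesz_kernel \<alpha> x y \<partial>\<nu>) \<le> ennreal e" for x
    proof -
      have "(\<integral>\<^sup>+ y. riesz_kernel \<alpha> x y * indicator A y \<partial>lborel)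
        \<le> (\<integral>\<^sup>+ y. riesz_kernel \<alpha> x y * indicator (ball x s) y + ennreal (e / 2) * indicator A y \<partial>lborel)"
      proof (rule nn_integral_mono)
        fix y
        have "riesz_kernel \<alpha> x y \<le> ennreal (e / 2)" if "\<not> dist x y < s"
          using that s \<alpha> unfolding s_powr[symmetric]
          by (auto simp: riesz_kernel_def intro!: ennreal_leI powr_mono2')
        then show "riesz_kernel \<alpha> x y * indicator A y
          \<le> riesz_kernel \<alpha> x y * indicator (ball x s) y + ennreal (e / 2) * indicator A y"
          by (auto simp: indicator_def)
      qed
      also have "\<dots> = (\<integral>\<^sup>+ y. riesz_kernel \<alpha> x y * indicator (ball x s) y \<partial>lborel) + ennreal (e / 2) * ennreal V"
        by (subst nn_integral_add)
           (auto intro!: borel_measurable_times_ennreal borel_measurable_riesz_kernel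
             borel_measurable_indicator
             simp: nn_integral_cmult_indicator emeasure_A)
      also have "\<dots> \<le> ennreal C + ennreal (e / 2) * ennreal V"
        by (intro add_right_mono C)
      also have "\<dots> = ennreal (C + e / 2 * V)"
        using C e V by (simp flip: ennreal_mult ennreal_plus)
      finally have "(\<integral>\<^sup>+ y. riesz_kernel \<alpha> x y \<partial>\<nu>) \<le> ennreal (C + e / 2 * V) / ennreal V"
        unfolding \<nu>_def
        by (subst nn_integral_uniform_measure) (auto simp: emeasure_A intro: divide_right_mono_ennreal)
      also have "\<dots> = ennreal (C / V + e / 2)"
        using C e V by (subst divide_ennreal) (simp_all add: add_divide_distrib)
      also have "\<dots> \<le> ennreal e"
        using CV by (intro ennreal_leI) linarith
      finally show ?thesis .
    qed
    \<comment> \<open>The total mass is one, so a uniform bound on the potential also bounds the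
      energy.\<close>
    have "riesz_energy \<alpha> \<nu> \<le> (\<integral>\<^sup>+ x. ennreal e \<partial>\<nu>)"
      unfolding riesz_energy_def by (intro nn_integral_mono potential)
    then have energy: "riesz_energy \<alpha> \<nu> \<le> ennreal e"
      by (simp add: emeasure_space_1)
    have AE: "AE x in \<nu>. x \<in> F"
      unfolding \<nu>_def by (intro AE_uniform_measureI AE_I2) (use p in \<open>auto simp: A_def\<close>)
    have "\<nu> \<in> unit_measures_on \<alpha> F"
      using radon_measure_uniform_measure_lborel[OF A_fin, folded \<nu>_def] energy AE
        AE_emeasure_completion[OF sets AE] emeasure_space_1 sets_eq_imp_space_eq[OF sets]
      by (auto simp: unit_measures_on_def intro: le_less_trans)
    then show "(INF \<nu>\<in>unit_measures_on \<alpha> F. riesz_energy \<alpha> \<nu>) \<le> 0 + ennreal e"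
      using energy by (auto intro: INF_lower2)
  qed
  then show ?thesis
    by (simp add: riesz_capacity_def)
qed

section \<open>The counterexample: growing balls at exponentially growing distances\<close>

definition sparse_balls :: "'a::real_normed_vector \<Rightarrow> 'a set" where
  "sparse_balls u = (\<Union>j. cball (4 ^ j *\<^sub>R u) (real j + 1))"

text \<open>This separates the distance \<open>4 ^ j\<close> of a centre from its radius
  \<open>j + 1\<close>, leaving at least \<open>2 ^ j - 1\<close>. It follows from
  \<open>4 ^ j = 2 ^ j + 2 ^ j * (2 ^ j - 1)\<close> and \<open>j \<le> 2 ^ j - 1\<close>.\<close>

lemma power_2_plus_le_power_4: "2 ^ j + real j \<le> 4 ^ j"
proof -
  have "2 ^ j + real j \<le> 2 ^ j + 2 ^ j * (2 ^ j - 1)"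
  proof -
    have "real j * 1 \<le> (2 ^ j - 1) * 2 ^ j"
    proof (rule mult_mono)
      have "real j + 1 \<le> 2 ^ j"
        using of_nat_mono[OF Suc_leI[OF less_exp[of j]], where 'a = real] by simp
      then show "real j \<le> 2 ^ j - 1"
        by simp
    qed auto
    then show ?thesis
      by (simp add: mult.commute)
  qed
  also have "\<dots> = 4 ^ j"
    by (simp add: algebra_simps flip: power_mult_distrib)
  finally show ?thesis .
qed

text \<open>The index of a ball is at most logarithmic in the norm of its points. This yields both
  local finiteness, hence closedness, and the count of balls meeting an annulus.\<close>

lemma index_bound_of_sparse_balls:
  assumes u: "norm u = 1" and y: "y \<in> cball (4 ^ j *\<^sub>R u) (real j + 1)"
  shows "2 ^ j \<le> norm y + 1"
proof -
  have "4 ^ j = norm (4 ^ j *\<^sub>R u)"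
    using u by simp
  also have "\<dots> \<le> norm y + (real j + 1)"
    using y norm_triangle_ineq2[of "4 ^ j *\<^sub>R u" y] by (simp add: dist_norm)
  finally show ?thesis
    using power_2_plus_le_power_4[of j] by simp
qed

lemma closed_sparse_balls:
  assumes "norm u = 1"
  shows "closed (sparse_balls u)"
  unfolding closed_def open_contains_ball
proof
  fix x assume x: "x \<in> - sparse_balls u"
  \<comment> \<open>For \<open>y\<close> within distance 1 of \<open>x\<close>,
    \<open>norm y + 1\<close> stays below \<open>2 ^ m\<close>, so only the balls of index up to
    \<open>m\<close> can contain \<open>y\<close>. The finite union of these is closed.\<close>
  obtain m where m: "norm x + 2 < 2 ^ m"
    using real_arch_pow[of 2 "norm x + 2"] by auto
  have "open (- (\<Union>j\<le>m. cball (4 ^ j *\<^sub>R u) (real j + 1)))"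
    by (intro open_Compl closed_UN) auto
  moreover have "x \<in> - (\<Union>j\<le>m. cball (4 ^ j *\<^sub>R u) (real j + 1))"
    using x by (auto simp: sparse_balls_def)
  ultimately obtain e where e: "0 < e" "ball x e \<subseteq> - (\<Union>j\<le>m. cball (4 ^ j *\<^sub>R u) (real j + 1))"
    by (rule openE)
  have "ball x (min e 1) \<subseteq> - sparse_balls u"
  proof
    fix y assume y: "y \<in> ball x (min e 1)"
    have "y \<notin> cball (4 ^ j *\<^sub>R u) (real j + 1)" for j
    proof
      assume yj: "y \<in> cball (4 ^ j *\<^sub>R u) (real j + 1)"
      have "norm y \<le> norm x + 1"
        using y norm_triangle_ineq2[of y x] by (simp add: dist_norm norm_minus_commute)
      then have "(2::real) ^ j < 2 ^ m"
        using index_bound_of_sparse_balls[OF assms yj] m by linarith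
      then have "j \<le> m"
        by simp
      then show False
        using e y yj by auto
    qed
    then show "y \<in> - sparse_balls u"
      by (simp add: sparse_balls_def)
  qed
  then show "\<exists>e>0. ball x e \<subseteq> - sparse_balls u"
    using e(1) by (intro exI[of _ "min e 1"]) auto
qed

text \<open>All centres lie on the ray through \<open>u\<close>; the opposite point
  \<open>- u\<close> has distance \<open>4 ^ j + 1\<close> from the centre of index
  \<open>j\<close>, which exceeds the radius.\<close>

lemma sparse_balls_neq_UNIV:
  assumes "norm u = 1"
  shows "sparse_balls u \<noteq> UNIV"
proof -
  have "- u \<notin> cball (4 ^ j *\<^sub>R u) (real j + 1)" for j
  proof -
    have "dist (4 ^ j *\<^sub>R u) (- u) = norm ((4 ^ j + 1) *\<^sub>R u)"
      by (simp add: dist_norm scaleR_add_left)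
    also have "\<dots> = 4 ^ j + 1"
      using assms by simp
    also have "\<dots> > real j + 1"
      using power_2_plus_le_power_4[of j] zero_less_power[of "2::real" j] by linarith
    finally show ?thesis
      by simp
  qed
  then show ?thesis
    unfolding sparse_balls_def by blast
qed

lemma riesz_capacity_sparse_balls:
  fixes u :: "real ^ 'n"
  assumes "0 < \<alpha>" "\<alpha> < real CARD('n)"
  shows "riesz_capacity \<alpha> (sparse_balls u) = \<infinity>"
proof (rule riesz_capacity_eq_infinity[OF assms])
  fix R :: real
  obtain j :: nat where "R \<le> real j"
    using real_arch_simple by blast
  then have "cball (4 ^ j *\<^sub>R u) R \<subseteq> cball (4 ^ j *\<^sub>R u) (real j + 1)"
    by (intro subset_cball) simp
  also have "\<dots> \<subseteq> sparse_balls u"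
    unfolding sparse_balls_def by blast
  finally show "\<exists>p. cball p R \<subseteq> sparse_balls u"
    by blast
qed

section \<open>Thinness of the counterexample at infinity\<close>

lemma summable_poly_over_geometric:
  fixes L \<beta> q :: real
  assumes "0 < L" "0 < \<beta>" "1 < q"
  shows "summable (\<lambda>k. (L * (real k + 2) + 1)\<^sup>2 * (2 * (L * (real k + 2) + 1)) powr \<beta> / q powr (real k * \<beta>))"
proof (rule summable_comparison_test_bigo)
  \<comment> \<open>Half of the exponential decay is kept as the geometric majorant; the other half
    absorbs the polynomial growth.\<close>
  show "summable (\<lambda>k. norm ((q powr (- \<beta> / 2)) ^ k))"
    using assms by (simp add: norm_power summable_geometric powr_less_one)
  show "(\<lambda>k. (L * (real k + 2) + 1)\<^sup>2 * (2 * (L * (real k + 2) + 1)) powr \<beta> / q powr (real k * \<beta>))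
      \<in> O(\<lambda>k. (q powr (- \<beta> / 2)) ^ k)"
    using assms by real_asymp
qed

text \<open>Only \<open>O(k)\<close> balls, of radius \<open>O(k)\<close>, meet the \<open>k\<close>-th annulus.\<close>

lemma thin_at_infinity_sparse_balls:
  fixes u :: "real ^ 'n"
  assumes \<alpha>: "\<alpha> < real CARD('n)" and u: "norm u = 1" and q: "1 < q"
  shows "thin_at_infinity \<alpha> q x0 (sparse_balls u)"
proof -
  \<comment> \<open>Both \<open>q\<close> and the shift of the centre to \<open>x0\<close> are
    bounded by one power of two, so that index bounds can be read off from exponents.\<close>
  obtain L where L: "0 < L" "q \<le> 2 ^ L" "norm x0 + 2 \<le> 2 ^ L"
  proof -
    obtain L where "max q (norm x0 + 2) < 2 ^ L"
      using real_arch_pow[of 2 "max q (norm x0 + 2)"] by auto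
    moreover from this q have "0 < L"
      by (cases L) auto
    ultimately show thesis
      using that by auto
  qed
  define M where "M k = L * (k + 2)" for k
  \<comment> \<open>The indices from 0 to \<open>M k\<close> give \<open>M k + 1\<close> balls, each
    of diameter at most \<open>2 * (M k + 1)\<close>; these are the \<open>N\<close> and
    \<open>d\<close> of the covering bound.\<close>
  define b where "b k = real (M k + 1) ^ 2 * (2 * real (M k + 1)) powr (real CARD('n) - \<alpha>)" for k
  show ?thesis
  proof (rule thin_at_infinityI)
    show "0 < q"
      using q by simp
    show "0 \<le> b k" for k
      by (simp add: b_def)
    show "riesz_capacity \<alpha> (sparse_balls u \<inter> {x. q ^ k \<le> dist x x0 \<and> dist x x0 < q ^ Suc k})
            \<le> ennreal (b k)" for k
      unfolding b_def
    proof (rule riesz_capacity_le_cover[where I = "{..M k}"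
            and A = "\<lambda>j. cball (4 ^ j *\<^sub>R u) (real j + 1)"])
      show "sparse_balls u \<inter> {x. q ^ k \<le> dist x x0 \<and> dist x x0 < q ^ Suc k}
        \<subseteq> (\<Union>j\<in>{..M k}. cball (4 ^ j *\<^sub>R u) (real j + 1))"
      proof
        fix y assume y: "y \<in> sparse_balls u \<inter> {x. q ^ k \<le> dist x x0 \<and> dist x x0 < q ^ Suc k}"
        then obtain j where j: "y \<in> cball (4 ^ j *\<^sub>R u) (real j + 1)"
          by (auto simp: sparse_balls_def)
        have q1: "1 \<le> q ^ Suc k"
          using q by (intro one_le_power) simp
        have "2 ^ j \<le> norm y + 1"
          by (rule index_bound_of_sparse_balls[OF u j])
        also have "\<dots> \<le> q ^ Suc k + (norm x0 + 1)"
          using y norm_triangle_ineq2[of y x0] by (simp add: dist_norm)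
        \<comment> \<open>As \<open>q ^ Suc k\<close> is at least 1, the sum can be turned into a
          product, of which \<open>Suc k\<close> factors \<open>2 ^ L\<close> bound the power of
          \<open>q\<close> and one more bounds \<open>norm x0 + 2\<close>; hence the
          \<open>k + 2\<close> in \<open>M\<close>.\<close>
        also have "\<dots> \<le> q ^ Suc k + q ^ Suc k * (norm x0 + 1)"
          using mult_right_mono[OF q1, of "norm x0 + 1"] by simp
        also have "\<dots> = q ^ Suc k * (norm x0 + 2)"
          by (simp add: algebra_simps)
        also have "\<dots> \<le> (2 ^ L) ^ Suc k * 2 ^ L"
          using L q by (intro mult_mono power_mono) auto
        also have "\<dots> = 2 ^ M k"
          by (simp add: M_def flip: power_mult power_add)
        finally have "j \<le> M k"
          by simp
        then show "y \<in> (\<Union>j\<in>{..M k}. cball (4 ^ j *\<^sub>R u) (real j + 1))"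
          using j by blast
      qed
      fix j x y
      assume "j \<in> {..M k}" "x \<in> cball (4 ^ j *\<^sub>R u) (real j + 1)" "y \<in> cball (4 ^ j *\<^sub>R u) (real j + 1)"
      then show "dist x y \<le> 2 * real (M k + 1)"
        using dist_triangle3[of x y "4 ^ j *\<^sub>R u"] by simp
    qed (use \<alpha> in auto)
    show "summable (\<lambda>k. b k / q powr (real k * (real CARD('n) - \<alpha>)))"
      using summable_poly_over_geometric[of "real L" "real CARD('n) - \<alpha>" q] L \<alpha> q
      by (simp add: b_def M_def algebra_simps)
  qed
qed

theorem theorem1p4:
  fixes \<alpha> :: real
  assumes "CARD('n::finite) \<ge> 3" and "0 < \<alpha>" and "\<alpha> \<le> 2"
  shows "(\<forall>F :: (real ^ 'n) set. closed F \<and> F \<noteq> UNIV \<longrightarrow>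
            (\<forall>x0 q. x0 \<notin> F \<and> 1 < q \<and> \<not> thin_at_infinity \<alpha> q x0 F
                    \<longrightarrow> riesz_capacity \<alpha> F = \<infinity>)) \<and>
         (\<exists>F :: (real ^ 'n) set. closed F \<and> F \<noteq> UNIV \<and> riesz_capacity \<alpha> F = \<infinity> \<and>
            (\<forall>x0 q. x0 \<notin> F \<and> 1 < q \<longrightarrow> thin_at_infinity \<alpha> q x0 F))"
proof -
  \<comment> \<open>Here \<alpha> \<le> 2 < 3 \<le> n gives the strict inequality on which the decay
    of the kernel rests.\<close>
  have \<alpha>: "0 < \<alpha>" "\<alpha> < real CARD('n)"
    using assms by auto
  obtain u :: "real ^ 'n" where u: "norm u = 1"
    using vector_choose_size[of 1] by auto
  show ?thesis
  proof (intro conjI allI impI exI[of _ "sparse_balls u"])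
    show "riesz_capacity \<alpha> F = \<infinity>"
      if "x0 \<notin> F \<and> 1 < q \<and> \<not> thin_at_infinity \<alpha> q x0 F" for F :: "(real ^ 'n) set" and x0 q
      using that thin_at_infinity_if_finite_capacity[OF \<alpha>(2)] by metis
    show "closed (sparse_balls u)"
      by (rule closed_sparse_balls[OF u])
    show "sparse_balls u \<noteq> UNIV"
      by (rule sparse_balls_neq_UNIV[OF u])
    show "riesz_capacity \<alpha> (sparse_balls u) = \<infinity>"
      by (rule riesz_capacity_sparse_balls[OF \<alpha>])
    show "thin_at_infinity \<alpha> q x0 (sparse_balls u)" if "x0 \<notin> sparse_balls u \<and> 1 < q" for x0 q
      using that thin_at_infinity_sparse_balls[OF \<alpha>(2) u] by blast
  qed
qed

end
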